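(* For $m\ge 5$, let $n(m)$ be the minimum number of vertices of a color complete $m$-pole. Then: (a) if $m$ is odd, $m+2\le n(m)\le 10m-37$; (b) if $m$ is even, $m+2\le n(m)\le 10m-40$.
   Context: An $m$-pole ($m\ge 1$), or multipole, $M=(V,E,\mathcal{E})$ consists of a finite set $V$ of vertices, a finite collection $E$ of edges (unordered pairs of vertices; parallel edges and loops may occur), and a set $\mathcal{E}=\{\epsilon_1,\dots,\epsilon_m\}$ of $m$ semiedges. Each semiedge is either incident to exactly one vertex, or is paired with another semiedge to form a free (isolated) edge, which has no vertices. All multipoles are cubic: for each vertex, the number of edges (loops counted twice) plus semiedges incident to it is $3$. A multipole may be disconnected, and $V$ may be empty. A Tait coloring of $M$ is a map $\phi:E\cup\mathcal{E}\to\{1,2,3\}$ such that the three edges/semiedges incident with any vertex receive distinct colors (so a multipole with a loop has none) and the two semiedges of any free edge receive the same color. A state of $M$ is a tuple $(\phi(\epsilon_1),\dots,\phi(\epsilon_m))$ with $\phi$ a Tait coloring of $M$. A tuple in $\{1,2,3\}^m$ is admissible if, with $m_i$ the number of entries equal to $i$, $m_1\equiv m_2\equiv m_3\equiv m\pmod 2$. (By the Parity Lemma every state is admissible.) $M$ is color complete if every admissible tuple is a state of $M$. *)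

theory Defs
  imports "HOL-Library.Multiset"
begin

datatype 'v attachment = Incident 'v | Paired nat

text \<open>Edges have their own identity, since parallel edges may be coloured differently;
  \<open>ends e\<close> is the unordered pair of end vertices of \<open>e\<close>, with \<open>{#v, v#}\<close> for a loop.
  The semiedges of an \<open>m\<close>-pole are \<open>1, \<dots>, m\<close>; a semiedge with attachment \<open>Paired j\<close> forms a
  free edge with the semiedge \<open>j\<close>.\<close>

record ('v, 'e) mpole =
  verts :: "'v set"
  edges :: "'e set"
  ends :: "'e \<Rightarrow> 'v multiset"
  arity :: nat
  attach :: "nat \<Rightarrow> 'v attachment"

datatype 'e link = Edge 'e | Semi nat

definition semiedges :: "('v, 'e) mpole \<Rightarrow> nat set" where
  "semiedges M = {1..arity M}"

definition links :: "('v, 'e) mpole \<Rightarrow> 'e link set" where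
  "links M = Edge ` edges M \<union> Semi ` semiedges M"

text \<open>The edges and semiedges at a vertex, a loop occurring twice.\<close>

definition incident :: "('v, 'e) mpole \<Rightarrow> 'v \<Rightarrow> 'e link multiset" where
  "incident M v =
     (\<Sum>e\<in>edges M. replicate_mset (count (ends M e) v) (Edge e)) +
     mset_set (Semi ` {i \<in> semiedges M. attach M i = Incident v})"

definition multipole :: "('v, 'e) mpole \<Rightarrow> bool" where
  "multipole M \<longleftrightarrow>
     arity M \<ge> 1 \<and> finite (verts M) \<and> finite (edges M) \<and>
     (\<forall>e\<in>edges M. size (ends M e) = 2 \<and> set_mset (ends M e) \<subseteq> verts M) \<and>
     (\<forall>i\<in>semiedges M. case attach M i of
         Incident v \<Rightarrow> v \<in> verts M
       | Paired j \<Rightarrow> j \<in> semiedges M \<and> j \<noteq> i \<and> attach M j = Paired i) \<and>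
     (\<forall>v\<in>verts M. size (incident M v) = 3)"

text \<open>Multiplicity at most one expresses distinctness of the three colours at \<open>v\<close>; in particular
  a loop, occurring twice at its vertex, rules out any colouring.\<close>

definition tait_coloring :: "('v, 'e) mpole \<Rightarrow> ('e link \<Rightarrow> nat) \<Rightarrow> bool" where
  "tait_coloring M \<phi> \<longleftrightarrow>
     \<phi> ` links M \<subseteq> {1, 2, 3} \<and>
     (\<forall>v\<in>verts M. \<forall>c. count (image_mset \<phi> (incident M v)) c \<le> 1) \<and>
     (\<forall>i\<in>semiedges M. \<forall>j. attach M i = Paired j \<longrightarrow> \<phi> (Semi i) = \<phi> (Semi j))"

definition states :: "('v, 'e) mpole \<Rightarrow> nat list set" where
  "states M = {map (\<lambda>i. \<phi> (Semi i)) [1..<Suc (arity M)] | \<phi>. tait_coloring M \<phi>}"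

definition admissible :: "nat \<Rightarrow> nat list \<Rightarrow> bool" where
  "admissible m xs \<longleftrightarrow>
     length xs = m \<and> set xs \<subseteq> {1, 2, 3} \<and>
     (\<forall>c\<in>{1, 2, 3}. count_list xs c mod 2 = m mod 2)"

definition color_complete :: "('v, 'e) mpole \<Rightarrow> bool" where
  "color_complete M \<longleftrightarrow> (\<forall>xs. admissible (arity M) xs \<longrightarrow> xs \<in> states M)"

text \<open>Vertices and edges are taken from \<open>nat\<close>, which covers all finite multipoles up to
  isomorphism. As \<open>Inf {} = 0\<close> on \<open>nat\<close>, a positive lower bound on the value includes the
  existence of a color complete \<open>m\<close>-pole, and then \<open>Inf\<close> is an attained minimum.\<close>

definition min_color_complete :: "nat \<Rightarrow> nat" where
  "min_color_complete m =
     Inf {card (verts M) | M :: (nat, nat) mpole.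
            multipole M \<and> arity M = m \<and> color_complete M}"

end

theory Submission
  imports Defs
begin

text \<open>Lower bound: in a color complete \<open>m\<close>-pole with \<open>m \<ge> 5\<close> any three semiedges can be coloured
  arbitrarily, so there are no free edges and no vertex carries two semiedges. Colouring the
  semiedges at a vertex and at its two neighbours suitably shows that some vertex carries none.
  Hence there are more than \<open>m\<close> vertices, and the handshake identity makes their number congruent
  to \<open>m\<close> modulo 2.

  Upper bound: there is a color complete 5-pole with 11 vertices, and a 5-pole \<open>G\<close> with 7 vertices in
  which the colours of three semiedges can be prescribed freely. Gluing the other two semiedges of
  \<open>G\<close> to two semiedges of a color complete \<open>m\<close>-pole gives a color complete \<open>(m + 1)\<close>-pole, since by
  parity the two colours demanded by \<open>G\<close> extend the remaining ones to an admissible tuple. This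
  gives at most \<open>7 * m - 24\<close> vertices. Both 5-poles were found by computer search.\<close>

section \<open>Multipoles given by lists\<close>

text \<open>The pairs of a vertex and the colour of an edge or semiedge end at it; for colours in \<open>{1, 2, 3}\<close>
  at a cubic multipole, the colouring is a Tait colouring iff these pairs are distinct.\<close>

definition halves :: "('v \<times> 'v) list \<Rightarrow> 'c list \<Rightarrow> 'v list \<Rightarrow> 'c list \<Rightarrow> ('v \<times> 'c) list" where
  "halves es cs ss xs = concat (map2 (\<lambda>(u, v) c. [(u, c), (v, c)]) es cs) @ zip ss xs"

text \<open>Edges are named by their list position, so repeated pairs become parallel edges.
  Semiedges are numbered from 1 but lists from 0, hence \<open>ss ! (i - 1)\<close>. This encoding
  has no free edges.\<close>

definition mpole_of :: "nat \<Rightarrow> (nat \<times> nat) list \<Rightarrow> nat list \<Rightarrow> (nat, nat) mpole" where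
  "mpole_of n es ss =
     \<lparr>verts = {..<n}, edges = {..<length es}, ends = (\<lambda>e. {#fst (es ! e), snd (es ! e)#}),
      arity = length ss, attach = (\<lambda>i. Incident (ss ! (i - 1)))\<rparr>"

text \<open>The multiplicity of a vertex in this list is its degree, a loop counting twice.\<close>

definition end_list :: "('v \<times> 'v) list \<Rightarrow> 'v list \<Rightarrow> 'v list" where
  "end_list es ss = concat (map (\<lambda>(u, v). [u, v]) es) @ ss"

definition cubic :: "nat \<Rightarrow> (nat \<times> nat) list \<Rightarrow> nat list \<Rightarrow> bool" where
  "cubic n es ss \<longleftrightarrow>
     set (end_list es ss) \<subseteq> {..<n} \<and> (\<forall>v<n. count_list (end_list es ss) v = 3)"

definition is_state :: "('v \<times> 'v) list \<Rightarrow> 'v list \<Rightarrow> nat list \<Rightarrow> bool" where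
  "is_state es ss xs \<longleftrightarrow>
     length xs = length ss \<and> set xs \<subseteq> {1, 2, 3} \<and>
     (\<exists>cs. length cs = length es \<and> set cs \<subseteq> {1, 2, 3} \<and> distinct (halves es cs ss xs))"

definition complete :: "nat \<Rightarrow> (nat \<times> nat) list \<Rightarrow> nat list \<Rightarrow> bool" where
  "complete n es ss \<longleftrightarrow>
     cubic n es ss \<and> (\<forall>xs. admissible (length ss) xs \<longrightarrow> is_state es ss xs)"

lemma map_fst_halves:
  assumes "length cs = length es" "length xs = length ss"
  shows "map fst (halves es cs ss xs) = end_list es ss"
proof -
  have "map fst (concat (map2 (\<lambda>(u, v) c. [(u, c), (v, c)]) es cs)) = concat (map (\<lambda>(u, v). [u, v]) es)"
    using assms(1) by (induction cs es rule: list_induct2) auto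
  then show ?thesis
    using assms(2) by (simp add: halves_def end_list_def)
qed

text \<open>Serves two purposes: passing from links as formal colours to their actual colours, and
  permuting the colours of a state.\<close>

lemma halves_map:
  "halves es (map f cs) ss (map f xs) = map (map_prod id f) (halves es cs ss xs)"
proof -
  have "concat (map2 (\<lambda>(u, v) c. [(u, c), (v, c)]) es (map f cs)) =
        map (map_prod id f) (concat (map2 (\<lambda>(u, v) c. [(u, c), (v, c)]) es cs))"
  proof (induction cs arbitrary: es)
    case (Cons c cs)
    then show ?case by (cases es) auto
  qed simp
  moreover have "zip ss (map f xs) = map (map_prod id f) (zip ss xs)"
    by (simp add: zip_map2 map_prod_def)
  ultimately show ?thesis
    by (simp add: halves_def)
qed

section \<open>Incidence multisets of multipoles given by lists\<close>

lemma mset_concat_map2: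
  assumes "length cs = length es"
  shows "mset (map snd (filter (\<lambda>h. fst h = v) (concat (map2 (\<lambda>(u, w) c. [(u, c), (w, c)]) es cs)))) =
         (\<Sum>i<length es. replicate_mset (count {#fst (es ! i), snd (es ! i)#} v) (cs ! i))"
  using assms
proof (induction es arbitrary: cs rule: rev_induct)
  case (snoc e es)
  then obtain c cs' where "cs = cs' @ [c]" "length cs' = length es"
    by (metis length_append_singleton length_Suc_conv_rev)
  then show ?case
    using snoc.IH[of cs'] by (cases e) (auto simp: nth_append intro!: sum.cong)
qed simp

text \<open>As for the edges, the induction appends at the end of the list, so that the earlier
  semiedges keep their numbers.\<close>

lemma mset_zip_semi:
  "mset (map snd (filter (\<lambda>h. fst h = v) (zip ss (map Semi [1..<Suc (length ss)])))) =
   mset_set (Semi ` {i \<in> {1..length ss}. ss ! (i - 1) = v})"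
proof (induction ss rule: rev_induct)
  case (snoc s ss)
  define I where "I = {i \<in> {1..length ss}. ss ! (i - 1) = v}"
  have "{i \<in> {1..length (ss @ [s])}. (ss @ [s]) ! (i - 1) = v} =
        I \<union> (if s = v then {Suc (length ss)} else {})"
    by (auto simp: I_def nth_append le_Suc_eq)
  moreover have "finite I" "Suc (length ss) \<notin> I"
    by (auto simp: I_def)
  moreover have "[1..<Suc (length (ss @ [s]))] = [1..<Suc (length ss)] @ [Suc (length ss)]"
    by simp
  ultimately show ?case
    using snoc unfolding I_def[symmetric] by (auto simp: image_iff simp del: upt_Suc)
qed simp

text \<open>With every link taken as its own colour, \<open>halves\<close> pairs each vertex with
  the links at it, so selecting one vertex recovers \<open>incident\<close>.\<close>

lemma incident_mpole_of:
  "incident (mpole_of n es ss) v =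
   mset (map snd (filter (\<lambda>h. fst h = v)
     (halves es (map Edge [0..<length es]) ss (map Semi [1..<Suc (length ss)]))))"
proof -
  have "(\<Sum>i<length es. replicate_mset (count {#fst (es ! i), snd (es ! i)#} v) (Edge i)) =
        mset (map snd (filter (\<lambda>h. fst h = v)
          (concat (map2 (\<lambda>(u, w) c. [(u, c), (w, c)]) es (map Edge [0..<length es])))))"
    by (subst mset_concat_map2) (auto intro!: sum.cong)
  then show ?thesis
    unfolding incident_def halves_def filter_append map_append mset_append mset_zip_semi
    by (simp add: mpole_of_def semiedges_def)
qed

lemma multipole_mpole_of:
  assumes "cubic n es ss" "ss \<noteq> []"
  shows "multipole (mpole_of n es ss)"
proof -
  have E: "set (end_list es ss) \<subseteq> {..<n}"
    and C: "\<And>v. v < n \<Longrightarrow> count_list (end_list es ss) v = 3"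
    using assms(1) by (simp_all add: cubic_def)
  have es: "fst e < n \<and> snd e < n" if "e \<in> set es" for e
  proof -
    have "{fst e, snd e} \<subseteq> set (end_list es ss)"
      using that by (induction es) (auto simp: end_list_def)
    then show ?thesis
      using E by blast
  qed
  have ss: "u < n" if "u \<in> set ss" for u
  proof -
    have "u \<in> set (end_list es ss)"
      using that by (simp add: end_list_def)
    then show ?thesis
      using E by blast
  qed
  have "size (incident (mpole_of n es ss) v) = 3" if "v < n" for v
  proof -
    let ?H = "halves es (map Edge [0..<length es]) ss (map Semi [1..<Suc (length ss)])"
    have length_filter: "length (filter (\<lambda>h. fst h = v) hs) = count_list (map fst hs) v"
      for hs :: "(nat \<times> nat link) list"
      by (induction hs) auto
    have "size (incident (mpole_of n es ss) v) = count_list (map fst ?H) v"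
      unfolding incident_mpole_of size_mset length_map length_filter by (rule refl)
    also have "\<dots> = 3"
      using C[OF that] by (subst map_fst_halves) (simp_all del: upt_Suc)
    finally show ?thesis .
  qed
  moreover have "fst (es ! i) < n \<and> snd (es ! i) < n" if "i < length es" for i
    using es[OF nth_mem[OF that]] .
  moreover have "ss ! (i - 1) < n" if "i \<in> {1..length ss}" for i
    using that by (intro ss nth_mem) auto
  moreover have "length ss \<ge> 1"
    using assms(2) by (cases ss) auto
  ultimately show ?thesis
    by (simp add: multipole_def mpole_of_def semiedges_def)
qed

lemma is_state_imp_states:
  assumes "is_state es ss xs"
  shows "xs \<in> states (mpole_of n es ss)"
proof -
  obtain cs where cs: "length cs = length es" "set cs \<subseteq> {1, 2, 3}" "distinct (halves es cs ss xs)"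
    and xs: "length xs = length ss" "set xs \<subseteq> {1, 2, 3}"
    using assms by (auto simp: is_state_def)
  define \<phi> where "\<phi> = case_link (\<lambda>i. cs ! i) (\<lambda>i. xs ! (i - 1))"
  have E: "map \<phi> (map Edge [0..<length es]) = cs"
    using cs(1) by (auto intro!: nth_equalityI simp: \<phi>_def)
  have S: "map \<phi> (map Semi [1..<Suc (length ss)]) = xs"
    using xs(1) by (auto intro!: nth_equalityI simp: \<phi>_def simp del: upt_Suc)
  let ?H = "halves es (map Edge [0..<length es]) ss (map Semi [1..<Suc (length ss)])"
  have H: "halves es cs ss xs = map (map_prod id \<phi>) ?H"
    using halves_map[of es \<phi> "map Edge [0..<length es]" ss "map Semi [1..<Suc (length ss)]"]
    unfolding E S .
  have "count (image_mset \<phi> (incident (mpole_of n es ss) v)) c \<le> 1" for v c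
  proof -
    have "image_mset \<phi> (incident (mpole_of n es ss) v) =
          mset (map snd (filter (\<lambda>h. fst h = v) (halves es cs ss xs)))"
      unfolding incident_mpole_of H by (simp add: filter_map o_def flip: mset_map)
    \<comment> \<open>Distinct pairs with the same vertex must differ in the colour.\<close>
    moreover have "distinct (map snd (filter (\<lambda>h. fst h = v) (halves es cs ss xs)))"
      using cs(3) by (auto simp: distinct_map inj_on_def)
    ultimately show ?thesis
      by (simp add: distinct_count_atmost_1)
  qed
  moreover have "\<phi> ` links (mpole_of n es ss) \<subseteq> {1, 2, 3}"
  proof -
    have "\<phi> (Edge i) \<in> set cs" if "i < length es" for i
      using cs(1) that by (simp add: \<phi>_def)
    moreover have "\<phi> (Semi i) \<in> set xs" if "i \<in> {1..length ss}" for i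
      using xs(1) that by (auto simp: \<phi>_def intro!: nth_mem)
    ultimately have "\<phi> ` links (mpole_of n es ss) \<subseteq> set cs \<union> set xs"
      by (auto simp: links_def semiedges_def mpole_of_def)
    then show ?thesis
      using cs(2) xs(2) by blast
  qed
  ultimately have "tait_coloring (mpole_of n es ss) \<phi>"
    by (auto simp: tait_coloring_def mpole_of_def)
  moreover have "xs = map (\<lambda>i. \<phi> (Semi i)) [1..<Suc (arity (mpole_of n es ss))]"
    using S by (simp add: mpole_of_def o_def)
  ultimately show ?thesis
    unfolding states_def by blast
qed

lemma color_complete_mpole_of:
  assumes "complete n es ss"
  shows "color_complete (mpole_of n es ss)"
  using assms is_state_imp_states by (auto simp: color_complete_def complete_def mpole_of_def)

lemma complete_imp_mpole:
  assumes "complete n es ss" "ss \<noteq> []"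
  shows "n \<in> {card (verts M) | M :: (nat, nat) mpole.
               multipole M \<and> arity M = length ss \<and> color_complete M}"
proof -
  have "multipole (mpole_of n es ss)"
    using assms by (auto simp: complete_def intro: multipole_mpole_of)
  moreover have "arity (mpole_of n es ss) = length ss" "card (verts (mpole_of n es ss)) = n"
    by (simp_all add: mpole_of_def)
  ultimately show ?thesis
    using color_complete_mpole_of[OF assms(1)]
    by (intro CollectI exI[of _ "mpole_of n es ss"]) simp
qed

section \<open>Gluing along two semiedges\<close>

text \<open>The shift by \<open>n\<close> makes the vertex sets disjoint. The two edges replacing
  the four glued semiedges come last, so their colours are simply appended to those of the old
  edges.\<close>

definition glue_edges ::
  "nat \<Rightarrow> (nat \<times> nat) list \<Rightarrow> nat \<Rightarrow> nat \<Rightarrow> (nat \<times> nat) list \<Rightarrow> nat \<Rightarrow> nat \<Rightarrow> (nat \<times> nat) list" where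
  "glue_edges n es p q es' r s = es @ map (map_prod ((+) n) ((+) n)) es' @ [(p, n + r), (q, n + s)]"

text \<open>Each new edge has the same two ends as the two semiedges it replaces, so gluing changes
  no degree.\<close>

lemma end_list_glue:
  "mset (end_list (glue_edges n es p q es' r s) (ss @ map ((+) n) ss')) =
   mset (end_list es (ss @ [p, q])) + image_mset ((+) n) (mset (end_list es' (r # s # ss')))"
proof -
  have "concat (map ((\<lambda>(u, v). [u, v]) \<circ> map_prod ((+) n) ((+) n)) es') =
        map ((+) n) (concat (map (\<lambda>(u, v). [u, v]) es'))"
    by (induction es') auto
  then show ?thesis
    by (simp add: end_list_def glue_edges_def)
qed

text \<open>The same observation with colours: a new edge coloured \<open>x\<close> contributes
  exactly the pairs of two semiedges coloured \<open>x\<close>.\<close>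

lemma halves_glue:
  assumes "length cs = length es" "length xs = length ss" "length cs' = length es'"
  shows "mset (halves (glue_edges n es p q es' r s) (cs @ cs' @ [x, y]) (ss @ map ((+) n) ss') (xs @ ys)) =
         mset (halves es cs (ss @ [p, q]) (xs @ [x, y])) +
         image_mset (map_prod ((+) n) id) (mset (halves es' cs' (r # s # ss') (x # y # ys)))"
proof -
  have "concat (map2 (\<lambda>(u, v) c. [(u, c), (v, c)]) (map (map_prod ((+) n) ((+) n)) es') cs') =
        map (map_prod ((+) n) id) (concat (map2 (\<lambda>(u, v) c. [(u, c), (v, c)]) es' cs'))"
    using assms(3) by (induction cs' es' rule: list_induct2) auto
  moreover have "zip (map ((+) n) ss') ys = map (map_prod ((+) n) id) (zip ss' ys)"
    by (simp add: zip_map1 map_prod_def)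
  ultimately show ?thesis
    using assms by (simp add: halves_def glue_edges_def)
qed

lemma cubic_glue:
  assumes "cubic n es (ss @ [p, q])" "cubic n' es' (r # s # ss')"
  shows "cubic (n + n') (glue_edges n es p q es' r s) (ss @ map ((+) n) ss')"
    (is "cubic _ ?es ?ss")
proof -
  let ?A = "end_list es (ss @ [p, q])" and ?B = "end_list es' (r # s # ss')"
  have A: "set ?A \<subseteq> {..<n}" "\<And>v. v < n \<Longrightarrow> count_list ?A v = 3"
    and B: "set ?B \<subseteq> {..<n'}" "\<And>v. v < n' \<Longrightarrow> count_list ?B v = 3"
    using assms by (auto simp: cubic_def)
  have "set (end_list ?es ?ss) = set ?A \<union> (+) n ` set ?B"
    by (metis end_list_glue set_image_mset set_mset_mset set_mset_union)
  then have "set (end_list ?es ?ss) \<subseteq> {..<n + n'}"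
    using A(1) B(1) by fastforce
  moreover have "count_list (end_list ?es ?ss) v = 3" if "v < n + n'" for v
  proof -
    have c: "count_list (end_list ?es ?ss) v = count_list ?A v + count_list (map ((+) n) ?B) v"
      using end_list_glue[of n es p q es' r s ss ss']
      by (metis count_mset count_union mset_map)
    show ?thesis
    proof (cases "v < n")
      case True
      then have "count_list (map ((+) n) ?B) v = 0"
        by (auto simp: count_list_0_iff)
      then show ?thesis using c A(2) True by simp
    next
      case False
      then have "count_list ?A v = 0"
        using A(1) by (auto simp: count_list_0_iff)
      moreover have "count_list (map ((+) n) ws) (n + (v - n)) = count_list ws (v - n)" for ws
        by (induction ws) simp_all
      ultimately show ?thesis using c B(2)[of "v - n"] False that by simp
    qed
  qed
  ultimately show ?thesis
    by (simp add: cubic_def)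
qed

lemma is_state_glue:
  assumes "set (end_list es (ss @ [p, q])) \<subseteq> {..<n}" "length xs = length ss"
    and "is_state es (ss @ [p, q]) (xs @ [x, y])" "is_state es' (r # s # ss') (x # y # ys)"
  shows "is_state (glue_edges n es p q es' r s) (ss @ map ((+) n) ss') (xs @ ys)"
proof -
  obtain cs where cs: "length cs = length es" "set cs \<subseteq> {1, 2, 3}"
    "distinct (halves es cs (ss @ [p, q]) (xs @ [x, y]))" (is "distinct ?A")
    using assms(3) by (auto simp: is_state_def)
  obtain cs' where cs': "length cs' = length es'" "set cs' \<subseteq> {1, 2, 3}"
    "distinct (halves es' cs' (r # s # ss') (x # y # ys))" (is "distinct ?B")
    using assms(4) by (auto simp: is_state_def)
  let ?B' = "map (map_prod ((+) n) id) ?B"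
  \<comment> \<open>The first pole lives below \<open>n\<close> and the shifted one from
    \<open>n\<close> on, so their pairs cannot clash.\<close>
  have "fst ` set ?A \<subseteq> {..<n}"
    using assms(1,2) map_fst_halves[OF cs(1), of "xs @ [x, y]" "ss @ [p, q]"]
    by (metis length_append list.set_map list.size(3,4))
  moreover have "fst ` set ?B' \<subseteq> {n..}"
    by auto
  ultimately have "set ?A \<inter> set ?B' = {}"
    by fastforce
  moreover have "distinct ?B'"
    using cs'(3) by (auto simp: distinct_map inj_on_def map_prod_def split: prod.splits)
  ultimately have "distinct (?A @ ?B')"
    using cs(3) by auto
  then have "distinct (halves (glue_edges n es p q es' r s) (cs @ cs' @ [x, y])
               (ss @ map ((+) n) ss') (xs @ ys))"
    using halves_glue[OF cs(1) assms(2) cs'(1), of n p q r s x y ss' ys]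
    by (metis mset_append mset_eq_imp_distinct_iff mset_map)
  moreover have "set (cs @ cs' @ [x, y]) \<subseteq> {1, 2, 3}"
    using cs(2) cs'(2) assms(3) by (auto simp: is_state_def)
  moreover have "length (cs @ cs' @ [x, y]) = length (glue_edges n es p q es' r s)"
    using cs(1) cs'(1) by (simp add: glue_edges_def)
  ultimately show ?thesis
    using assms(2-4) unfolding is_state_def by (intro conjI exI[of _ "cs @ cs' @ [x, y]"]) auto
qed

section \<open>Invariance of states under permuting the colours\<close>

lemma is_state_permute:
  assumes "is_state es ss xs" "bij_betw f {1, 2, 3} {1, 2, 3}"
  shows "is_state es ss (map f xs)"
proof -
  obtain cs where cs: "length cs = length es" "set cs \<subseteq> {1, 2, 3}" "distinct (halves es cs ss xs)"
    and xs: "length xs = length ss" "set xs \<subseteq> {1, 2, 3}"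
    using assms(1) by (auto simp: is_state_def)
  \<comment> \<open>\<open>f\<close> is known to be injective only on the three colours, so all
    second components have to be located there.\<close>
  have "snd ` set (halves es cs ss xs) \<subseteq> {1, 2, 3}"
    using cs(2) xs(2) by (force simp: halves_def dest: set_zip_leftD set_zip_rightD)
  then have "set (halves es cs ss xs) \<subseteq> UNIV \<times> {1, 2, 3}"
    by force
  moreover have "inj_on (map_prod id f) (UNIV \<times> {1, 2, 3})"
    using assms(2) by (intro map_prod_inj_on) (auto simp: bij_betw_def)
  ultimately have "inj_on (map_prod id f) (set (halves es cs ss xs))"
    by (rule inj_on_subset[rotated])
  then have "distinct (halves es (map f cs) ss (map f xs))"
    using cs(3) by (simp add: halves_map distinct_map)
  moreover have "f ` A \<subseteq> {1, 2, 3}" if "A \<subseteq> {1, 2, 3}" for A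
    using that assms(2) by (metis bij_betw_imp_surj_on image_mono)
  ultimately show ?thesis
    using cs(1,2) xs unfolding is_state_def
    by (intro conjI exI[of _ "map f cs"]) (simp_all only: length_map list.set_map)
qed
section \<open>A color complete 5-pole and a gadget raising the arity\<close>

definition color_perms :: "nat list list" where
  "color_perms = [[0, 1, 2, 3], [0, 1, 3, 2], [0, 2, 1, 3], [0, 2, 3, 1], [0, 3, 1, 2], [0, 3, 2, 1]]"

text \<open>A list of states up to permutation of the colours suffices; the index 0 of the lists in
  \<open>color_perms\<close> is a dummy.\<close>

definition recolors_into :: "nat list \<Rightarrow> nat list list \<Rightarrow> bool" where
  "recolors_into xs yss \<longleftrightarrow> (\<exists>l \<in> set color_perms. map ((!) l) xs \<in> set yss)"

lemma is_state_recolor: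
  assumes "recolors_into xs yss" "\<And>ys. ys \<in> set yss \<Longrightarrow> is_state es ss ys" "set xs \<subseteq> {1, 2, 3}"
  shows "is_state es ss xs"
proof -
  obtain l where l: "l \<in> set color_perms" "map ((!) l) xs \<in> set yss"
    using assms(1) by (auto simp: recolors_into_def)
  \<comment> \<open>The inverse permutation leads from the listed state back to
    \<open>xs\<close>.\<close>
  let ?g = "inv_into {1, 2, 3} ((!) l)"
  have bij: "bij_betw ((!) l) {1, 2, 3} {1, 2, 3}"
    using l(1) by (auto simp: color_perms_def bij_betw_def inj_on_def)
  then have "map ?g (map ((!) l) xs) = map id xs"
    using assms(3) unfolding map_map by (intro map_cong) (auto simp: bij_betw_def subset_iff)
  then show ?thesis
    using is_state_permute[OF assms(2)[OF l(2)] bij_betw_inv_into[OF bij]] by simp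
qed

lemma is_stateI:
  assumes "length xs = length ss" "set xs \<subseteq> {1, 2, 3}" "length cs = length es"
    "set cs \<subseteq> {1, 2, 3}" "distinct (halves es cs ss xs)"
  shows "is_state es ss xs"
  using assms unfolding is_state_def by blast

definition base_edges :: "(nat \<times> nat) list" where
  "base_edges = [(5, 8), (2, 6), (2, 3), (1, 6), (9, 1), (0, 10), (9, 4), (4, 3), (0, 5), (7, 8), (4, 8), (0, 6), (9, 10), (2, 7)]"

definition base_semis :: "nat list" where
  "base_semis = [10, 3, 1, 5, 7]"

text \<open>An admissible 5-tuple has one colour three times and the others once. The 60 such tuples
  form 10 orbits of size 6 under permuting the colours; each is represented by the tuple in which
  the colours first appear in increasing order.\<close>

definition base_states :: "nat list list" where
  "base_states =
     [[1, 1, 1, 2, 3],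
      [1, 1, 2, 1, 3],
      [1, 1, 2, 3, 1],
      [1, 2, 1, 1, 3],
      [1, 2, 1, 3, 1],
      [1, 2, 2, 2, 3],
      [1, 2, 2, 3, 2],
      [1, 2, 3, 1, 1],
      [1, 2, 3, 2, 2],
      [1, 2, 3, 3, 3]]"

lemma cubic_base: "cubic 11 base_edges base_semis"
  by (simp add: cubic_def end_list_def base_edges_def base_semis_def
      lessThan_Suc numeral_eq_Suc less_Suc_eq All_less_Suc)

text \<open>Each witness \<open>cs\<close> lists the edge colours in the order of
  \<open>base_edges\<close>; what remains is a check of distinctness.\<close>

lemma is_state_base:
  assumes "xs \<in> set base_states"
  shows "is_state base_edges base_semis xs"
proof -
  have "is_state base_edges base_semis [1, 1, 1, 2, 3]"
    by (rule is_stateI[where cs = "[1, 2, 3, 3, 2, 2, 1, 2, 3, 2, 3, 1, 3, 1]"])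
      (simp_all add: halves_def base_edges_def base_semis_def)
  moreover
  have "is_state base_edges base_semis [1, 1, 2, 1, 3]"
    by (rule is_stateI[where cs = "[3, 2, 3, 3, 1, 3, 3, 2, 2, 2, 1, 1, 2, 1]"])
      (simp_all add: halves_def base_edges_def base_semis_def)
  moreover
  have "is_state base_edges base_semis [1, 1, 2, 3, 1]"
    by (rule is_stateI[where cs = "[2, 1, 3, 3, 1, 3, 3, 2, 1, 3, 1, 2, 2, 2]"])
      (simp_all add: halves_def base_edges_def base_semis_def)
  moreover
  have "is_state base_edges base_semis [1, 2, 1, 1, 3]"
    by (rule is_stateI[where cs = "[3, 3, 1, 2, 3, 3, 1, 3, 2, 1, 2, 1, 2, 2]"])
      (simp_all add: halves_def base_edges_def base_semis_def)
  moreover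
  have "is_state base_edges base_semis [1, 2, 1, 3, 1]"
    by (rule is_stateI[where cs = "[1, 3, 1, 2, 3, 3, 1, 3, 2, 3, 2, 1, 2, 2]"])
      (simp_all add: halves_def base_edges_def base_semis_def)
  moreover
  have "is_state base_edges base_semis [1, 2, 2, 2, 3]"
    by (rule is_stateI[where cs = "[1, 2, 3, 3, 1, 2, 2, 1, 3, 2, 3, 1, 3, 1]"])
      (simp_all add: halves_def base_edges_def base_semis_def)
  moreover
  have "is_state base_edges base_semis [1, 2, 2, 3, 2]"
    by (rule is_stateI[where cs = "[1, 2, 3, 3, 1, 3, 3, 1, 2, 3, 2, 1, 2, 1]"])
      (simp_all add: halves_def base_edges_def base_semis_def)
  moreover
  have "is_state base_edges base_semis [1, 2, 3, 1, 1]"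
    by (rule is_stateI[where cs = "[2, 3, 1, 2, 1, 2, 2, 3, 3, 3, 1, 1, 3, 2]"])
      (simp_all add: halves_def base_edges_def base_semis_def)
  moreover
  have "is_state base_edges base_semis [1, 2, 3, 2, 2]"
    by (rule is_stateI[where cs = "[3, 2, 1, 1, 2, 2, 1, 3, 1, 1, 2, 3, 3, 3]"])
      (simp_all add: halves_def base_edges_def base_semis_def)
  moreover
  have "is_state base_edges base_semis [1, 2, 3, 3, 3]"
    by (rule is_stateI[where cs = "[2, 1, 3, 2, 1, 2, 2, 1, 1, 1, 3, 3, 3, 2]"])
      (simp_all add: halves_def base_edges_def base_semis_def)
  ultimately show ?thesis
    using assms by (auto simp: base_states_def)
qed

definition gadget_edges :: "(nat \<times> nat) list" where
  "gadget_edges = [(4, 3), (2, 5), (1, 2), (5, 0), (5, 6), (2, 4), (6, 1), (6, 3)]"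

text \<open>The first two semiedges are the ones to be glued.\<close>

definition gadget_semis :: "nat list" where
  "gadget_semis = [0, 4, 3, 1, 0]"

text \<open>One state for each of the five equality patterns of the last three entries. Vertex 0
  carries the first and the last semiedge, so these two colours always differ and the gadget itself
  is not color complete.\<close>

definition gadget_states :: "nat list list" where
  "gadget_states =
     [[1, 1, 1, 2, 3],
      [1, 2, 1, 1, 3],
      [1, 2, 2, 3, 2],
      [1, 2, 3, 2, 2],
      [1, 2, 3, 3, 3]]"

lemma cubic_gadget: "cubic 7 gadget_edges gadget_semis"
  by (simp add: cubic_def end_list_def gadget_edges_def gadget_semis_def
      lessThan_Suc numeral_eq_Suc less_Suc_eq All_less_Suc)

lemma is_state_gadget:
  assumes "xs \<in> set gadget_states"
  shows "is_state gadget_edges gadget_semis xs"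
proof -
  have "is_state gadget_edges gadget_semis [1, 1, 1, 2, 3]"
    by (rule is_stateI[where cs = "[3, 1, 3, 2, 3, 2, 1, 2]"])
      (simp_all add: halves_def gadget_edges_def gadget_semis_def)
  moreover
  have "is_state gadget_edges gadget_semis [1, 2, 1, 1, 3]"
    by (rule is_stateI[where cs = "[3, 3, 2, 2, 1, 1, 3, 2]"])
      (simp_all add: halves_def gadget_edges_def gadget_semis_def)
  moreover
  have "is_state gadget_edges gadget_semis [1, 2, 2, 3, 2]"
    by (rule is_stateI[where cs = "[1, 2, 1, 3, 1, 3, 2, 3]"])
      (simp_all add: halves_def gadget_edges_def gadget_semis_def)
  moreover
  have "is_state gadget_edges gadget_semis [1, 2, 3, 2, 2]"
    by (rule is_stateI[where cs = "[1, 2, 1, 3, 1, 3, 3, 2]"])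
      (simp_all add: halves_def gadget_edges_def gadget_semis_def)
  moreover
  have "is_state gadget_edges gadget_semis [1, 2, 3, 3, 3]"
    by (rule is_stateI[where cs = "[1, 1, 2, 2, 3, 3, 1, 2]"])
      (simp_all add: halves_def gadget_edges_def gadget_semis_def)
  ultimately show ?thesis
    using assms by (auto simp: gadget_states_def)
qed

section \<open>Color completeness of the 5-pole and of its extensions\<close>

lemma complete_base: "complete 11 base_edges base_semis"
proof -
  \<comment> \<open>Evaluated over all 243 tuples of length 5.\<close>
  have "\<forall>xs \<in> set (List.n_lists 5 [1, 2, 3]). admissible 5 xs \<longrightarrow> recolors_into xs base_states"
    by code_simp
  moreover have "xs \<in> set (List.n_lists 5 [1, 2, 3])" if "admissible 5 xs" for xs
    using that by (auto simp: set_n_lists admissible_def)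
  ultimately have "recolors_into xs base_states" if "admissible 5 xs" for xs
    using that by blast
  then have "is_state base_edges base_semis xs" if "admissible 5 xs" for xs
    using that is_state_recolor[OF _ is_state_base] by (auto simp: admissible_def)
  moreover have "length base_semis = 5"
    by (simp add: base_semis_def)
  ultimately show ?thesis
    using cubic_base by (simp add: complete_def)
qed

text \<open>Up to permuting colours a triple is determined by its equality pattern, and every
  pattern ends some member of \<open>gadget_states\<close>. Admissibility is recorded for the parity
  argument in the gluing.\<close>

lemma gadget_extend:
  assumes "{x, y, z} \<subseteq> {1, 2, 3}"
  obtains p q where "is_state gadget_edges gadget_semis [p, q, x, y, z]" "admissible 5 [p, q, x, y, z]"
proof -
  have *: "\<forall>x \<in> set [1, 2, 3]. \<forall>y \<in> set [1, 2, 3]. \<forall>z \<in> set [1, 2, 3].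
          \<exists>p \<in> set [1, 2, 3]. \<exists>q \<in> set [1, 2, 3].
            admissible 5 [p, q, x, y, z] \<and> recolors_into [p, q, x, y, z] gadget_states"
    by code_simp
  have "x \<in> set [1, 2, 3]" "y \<in> set [1, 2, 3]" "z \<in> set [1, 2, 3]"
    using assms by simp_all
  from *[rule_format, OF this] obtain p q
    where "admissible 5 [p, q, x, y, z]" "recolors_into [p, q, x, y, z] gadget_states"
    by blast
  then show ?thesis
    using that[of p q] is_state_recolor[OF _ is_state_gadget] by (auto simp: admissible_def)
qed

text \<open>Two semiedges are consumed and three of the gadget appear, so the arity rises by one.
  The gadget chooses the colours of the two connecting edges, and parity makes this choice
  acceptable to the old pole.\<close>

lemma complete_extend:
  assumes "complete n es (ss @ [p, q])"
  shows "complete (n + 7) (glue_edges n es p q gadget_edges 0 4) (ss @ map ((+) n) [3, 1, 0])"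
proof -
  have A: "cubic n es (ss @ [p, q])"
    using assms by (simp add: complete_def)
  have B: "cubic 7 gadget_edges (0 # 4 # [3, 1, 0])"
    using cubic_gadget by (simp add: gadget_semis_def)
  have "is_state (glue_edges n es p q gadget_edges 0 4) (ss @ map ((+) n) [3, 1, 0]) zs"
    if adm: "admissible (length ss + 3) zs" for zs
  proof -
    define xs where "xs = take (length ss) zs"
    have len: "length xs = length ss" "length (drop (length ss) zs) = 3"
      using adm by (simp_all add: xs_def admissible_def)
    from len(2) obtain x y z where "drop (length ss) zs = [x, y, z]"
      unfolding numeral_3_eq_3 length_Suc_conv by auto
    then have zs: "zs = xs @ [x, y, z]"
      by (metis append_take_drop_id xs_def)
    then have "{x, y, z} \<subseteq> {1, 2, 3}"
      using adm by (simp add: admissible_def)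
    then obtain a b where ab: "is_state gadget_edges gadget_semis [a, b, x, y, z]"
      "admissible 5 [a, b, x, y, z]"
      by (rule gadget_extend)
    \<comment> \<open>For a fixed colour, \<open>k\<close>, \<open>u\<close> and \<open>w\<close>
      will be its multiplicities in \<open>xs\<close>, \<open>[a, b]\<close> and
      \<open>[x, y, z]\<close>, and \<open>l\<close> is \<open>length ss\<close>. Adding the two
      hypotheses cancels \<open>w\<close> modulo 2.\<close>
    have parity: "(k + u) mod 2 = (l + 2) mod 2"
      if "(u + w) mod 2 = 5 mod 2" "(k + w) mod 2 = (l + 3) mod 2" for k u w l :: nat
    proof -
      have "odd (u + w)" "even (k + w) \<longleftrightarrow> odd l"
        using that by (simp_all add: mod2_eq_if split: if_splits)
      then show ?thesis
        by (auto simp: mod2_eq_if)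
    qed
    have "count_list (xs @ [a, b]) c mod 2 = (length ss + 2) mod 2" if c: "c \<in> {1, 2, 3}" for c
      unfolding count_list_append
    proof (rule parity)
      have "count_list ([a, b] @ [x, y, z]) c mod 2 = 5 mod 2"
        using ab(2) c unfolding admissible_def append.simps by blast
      then show "(count_list [a, b] c + count_list [x, y, z] c) mod 2 = 5 mod 2"
        unfolding count_list_append .
      have "count_list (xs @ [x, y, z]) c mod 2 = (length ss + 3) mod 2"
        using adm c unfolding zs admissible_def by blast
      then show "(count_list xs c + count_list [x, y, z] c) mod 2 = (length ss + 3) mod 2"
        unfolding count_list_append .
    qed
    moreover have "set (xs @ [a, b]) \<subseteq> {1, 2, 3}"
      using ab(2) adm zs by (simp add: admissible_def)
    ultimately have "admissible (length (ss @ [p, q])) (xs @ [a, b])"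
      using len(1) unfolding admissible_def by simp
    then have "is_state es (ss @ [p, q]) (xs @ [a, b])"
      using assms by (simp add: complete_def)
    then show ?thesis
      using is_state_glue[of es ss p q n xs a b gadget_edges 0 4 "[3, 1, 0]" "[x, y, z]"]
        A ab(1) len(1) zs by (simp add: cubic_def gadget_semis_def)
  qed
  moreover have "length (ss @ map ((+) n) [3, 1, 0]) = length ss + 3"
    by simp
  ultimately show ?thesis
    using cubic_glue[OF A B] unfolding complete_def by metis
qed

text \<open>The bound is 11 for \<open>m = 5\<close>, the size of the base pole, and each gadget
  adds 7 vertices. The last two semiedges are the ones glued.\<close>

lemma ex_complete:
  assumes "m \<ge> 5"
  shows "\<exists>es ss. length ss = m \<and> complete (7 * m - 24) es ss"
  using assms
proof (induction m rule: dec_induct)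
  case base
  then show ?case
    using complete_base by (intro exI[of _ base_edges] exI[of _ base_semis]) (simp add: base_semis_def)
next
  case (step m)
  then obtain es ss where ss: "length ss = m" "complete (7 * m - 24) es ss"
    by auto
  have "length ss = Suc (Suc (m - 2))"
    using ss(1) step(1) by simp
  then obtain ss' p q where "ss = ss' @ [p, q]"
    by (metis append_Cons append_Nil append_assoc length_Suc_conv_rev)
  then show ?case
    using complete_extend[of "7 * m - 24" es ss' p q] ss step(1)
    by (intro exI[of _ "glue_edges (7 * m - 24) es p q gadget_edges 0 4"]
        exI[of _ "ss' @ map ((+) (7 * m - 24)) [3, 1, 0]"])
      (auto simp: algebra_simps Suc_diff_le)
qed

section \<open>The lower bound\<close>

lemma count_list_map_upt:
  "count_list (map g [1..<Suc m]) c = card {i \<in> {1..m}. g i = c}"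
proof (induction m)
  case (Suc m)
  have "{i \<in> {1..Suc m}. g i = c} = {i \<in> {1..m}. g i = c} \<union> (if g (Suc m) = c then {Suc m} else {})"
    by (auto simp: le_Suc_eq)
  then show ?case
    using Suc by simp
qed simp

text \<open>By parity, two free positions suffice to complete any partial assignment admissibly.\<close>

lemma admissible_complete:
  fixes g :: "nat \<Rightarrow> nat"
  assumes "p \<in> {1..m}" "q \<in> {1..m}" "p \<noteq> q" "\<And>i. g i \<in> {1, 2, 3}"
  obtains a b where "admissible m (map (g(p := a, q := b)) [1..<Suc m])"
proof -
  define I where "I = {1..m} - {p, q}"
  define N where "N c = card {i \<in> I. g i = c}" for c
  have fin: "finite I"
    by (simp add: I_def)
  have "card I + 2 = m"
  proof -
    have "card {1..m} = card I + card {p, q}"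
      unfolding I_def using assms(1,2)
      by (subst card_Diff_subset) (auto intro!: le_add_diff_inverse2[symmetric] card_mono
        simp del: card_atLeastAtMost card_insert_disjoint)
    then show ?thesis
      using assms(3) by simp
  qed
  moreover have "card I = N 1 + N 2 + N 3"
  proof -
    have "I = {i \<in> I. g i = 1} \<union> {i \<in> I. g i = 2} \<union> {i \<in> I. g i = 3}"
      using assms(4) by auto
    then have "card I = card ({i \<in> I. g i = 1} \<union> {i \<in> I. g i = 2} \<union> {i \<in> I. g i = 3})"
      by (rule arg_cong)
    also have "\<dots> = N 1 + N 2 + N 3"
      unfolding N_def using fin by (subst card_Un_disjoint; auto)+
    finally show ?thesis .
  qed
  ultimately have total: "N 1 + N 2 + N 3 + 2 = m"
    by simp
  have count: "count_list (map (g(p := a, q := b)) [1..<Suc m]) c =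
      N c + (if a = c then 1 else 0) + (if b = c then 1 else 0)" for a b c
  proof -
    have "{i \<in> {1..m}. (g(p := a, q := b)) i = c} =
          {i \<in> I. g i = c} \<union> ((if a = c then {p} else {}) \<union> (if b = c then {q} else {}))"
      using assms(1-3) by (auto simp: I_def)
    moreover have "{i \<in> I. g i = c} \<inter> ((if a = c then {p} else {}) \<union> (if b = c then {q} else {})) = {}"
      by (auto simp: I_def)
    ultimately show ?thesis
      unfolding count_list_map_upt N_def using fin assms(3) by (simp add: card_Un_disjoint)
  qed
  have "\<exists>a \<in> {1, 2, 3}. \<exists>b \<in> {1, 2, 3}. \<forall>c \<in> {1, 2, 3}.
          (N c + (if a = c then 1 else 0) + (if b = c then 1 else 0)) mod 2 = m mod 2"
  proof -
    \<comment> \<open>The number of colours whose count has the wrong parity is even, hence 0 or 2.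
      In the first case \<open>a\<close> and \<open>b\<close> are equal, in the second they are the
      two wrong colours.\<close>
    have "even m \<longleftrightarrow> even (N 1 + N 2 + N 3)"
      by (simp flip: total)
    then consider
        "even (N 1 + m)" "even (N 2 + m)" "even (N 3 + m)"
      | "odd (N 1 + m)" "odd (N 2 + m)" "even (N 3 + m)"
      | "odd (N 1 + m)" "even (N 2 + m)" "odd (N 3 + m)"
      | "even (N 1 + m)" "odd (N 2 + m)" "odd (N 3 + m)"
      by (cases "even (N 1)"; cases "even (N 2)"; cases "even (N 3)"; simp)
    then show ?thesis
    proof cases
      case 1
      then show ?thesis
        by (intro bexI[of _ 1]) (auto simp: mod2_eq_if)
    next
      case 2
      then show ?thesis
        by (intro bexI[of _ 1] bexI[of _ 2]) (auto simp: mod2_eq_if)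
    next
      case 3
      then show ?thesis
        by (intro bexI[of _ 1] bexI[of _ 3]) (auto simp: mod2_eq_if)
    next
      case 4
      then show ?thesis
        by (intro bexI[of _ 2] bexI[of _ 3]) (auto simp: mod2_eq_if)
    qed
  qed
  then obtain a b where ab: "a \<in> {1, 2, 3}" "b \<in> {1, 2, 3}"
    "\<forall>c \<in> {1, 2, 3}. (N c + (if a = c then 1 else 0) + (if b = c then 1 else 0)) mod 2 = m mod 2"
    by blast
  have "set (map (g(p := a, q := b)) [1..<Suc m]) \<subseteq> {1, 2, 3}"
    using ab(1,2) assms(4) unfolding set_map by (intro image_subsetI) (simp add: fun_upd_def del: insert_iff)
  then show ?thesis
    using ab(3) that[of a b] unfolding admissible_def count by (simp del: upt_Suc)
qed

text \<open>At least two of the five or more semiedges lie outside \<open>I\<close>, and these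
  absorb the parity condition.\<close>

lemma ex_coloring:
  assumes "color_complete M" "arity M \<ge> 5" "I \<subseteq> {1..arity M}" "card I \<le> 3" "\<And>i. g i \<in> {1, 2, 3}"
  shows "\<exists>\<phi>. tait_coloring M \<phi> \<and> (\<forall>i \<in> I. \<phi> (Semi i) = g i)"
proof -
  let ?m = "arity M"
  have "card ({1..?m} - I) = ?m - card I"
    using assms(3) by (subst card_Diff_subset) (auto intro: finite_subset)
  then have "2 \<le> card ({1..?m} - I)"
    using assms(2,4) by simp
  then obtain T where "T \<subseteq> {1..?m} - I" "card T = 2"
    by (rule obtain_subset_with_card_n)
  then obtain p q where pq: "p \<in> {1..?m} - I" "q \<in> {1..?m} - I" "p \<noteq> q"
    by (auto simp: card_2_iff)
  then obtain a b where ab: "admissible ?m (map (g(p := a, q := b)) [1..<Suc ?m])"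
    using admissible_complete[of p ?m q g] assms(5) by blast
  then obtain \<phi> where \<phi>: "tait_coloring M \<phi>"
    "map (\<lambda>i. \<phi> (Semi i)) [1..<Suc ?m] = map (g(p := a, q := b)) [1..<Suc ?m]"
    using assms(1) unfolding color_complete_def states_def by (smt (verit, best) mem_Collect_eq)
  have "\<phi> (Semi i) = g i" if "i \<in> I" for i
  proof -
    have "i \<in> set [1..<Suc ?m]"
      using that assms(3) by auto
    then have "\<phi> (Semi i) = (g(p := a, q := b)) i"
      using \<phi>(2) by (metis map_eq_conv)
    then show ?thesis
      using pq that by auto
  qed
  then show ?thesis
    using \<phi>(1) by blast
qed

section \<open>Constraints at a vertex and counting of incidences\<close>

lemma pair_subset_mset:
  assumes "a \<in># N" "b \<in># N" "a \<noteq> b"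
  shows "{#a, b#} \<subseteq># N"
  using assms by (simp add: insert_subset_eq_iff in_diff_count)

text \<open>The multiset form admits \<open>a = b\<close>, where it yields a contradiction; this is
  how loops are excluded later.\<close>

lemma coloring_neq:
  assumes "tait_coloring M \<phi>" "v \<in> verts M" "{#a, b#} \<subseteq># incident M v"
  shows "\<phi> a \<noteq> \<phi> b"
proof
  assume "\<phi> a = \<phi> b"
  moreover have "{#\<phi> a, \<phi> b#} \<subseteq># image_mset \<phi> (incident M v)"
    using image_mset_subseteq_mono[OF assms(3), of \<phi>] by simp
  then have "count {#\<phi> a, \<phi> b#} (\<phi> a) \<le> count (image_mset \<phi> (incident M v)) (\<phi> a)"
    by (rule mset_subset_eq_count)
  moreover have "count (image_mset \<phi> (incident M v)) (\<phi> a) \<le> 1"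
    using assms(1,2) by (simp add: tait_coloring_def)
  ultimately show False
    by simp
qed

lemma coloring_range:
  assumes "tait_coloring M \<phi>" "l \<in> links M"
  shows "\<phi> l \<in> {1, 2, 3}"
  using assms unfolding tait_coloring_def by blast

lemma count_incident_Edge:
  assumes "finite (edges M)" "e \<in> edges M"
  shows "count (incident M v) (Edge e) = count (ends M e) v"
proof -
  have "count (\<Sum>e\<in>edges M. replicate_mset (count (ends M e) v) (Edge e)) (Edge e) =
        (\<Sum>e'\<in>edges M. if e' = e then count (ends M e) v else 0)"
    unfolding count_sum by (intro sum.cong) auto
  moreover have "count (mset_set (Semi ` {i \<in> semiedges M. attach M i = Incident v})) (Edge e) = 0"
    by (auto simp: count_eq_zero_iff semiedges_def)
  ultimately show ?thesis
    using assms by (simp add: incident_def)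
qed

lemma count_incident_Semi:
  assumes "i \<in> semiedges M" "attach M i = Incident v"
  shows "count (incident M v) (Semi i) = 1"
proof -
  have "count (\<Sum>e\<in>edges M. replicate_mset (count (ends M e) v) (Edge e)) (Semi i) = 0"
    unfolding count_sum by (intro sum.neutral) auto
  moreover have "count (mset_set (Semi ` {i \<in> semiedges M. attach M i = Incident v})) (Semi i) = 1"
    using assms by (subst count_mset_set) (auto simp: semiedges_def)
  ultimately show ?thesis
    by (simp add: incident_def)
qed

lemma size_incident:
  fixes M :: "('a, 'b) mpole"
  shows "size (incident M v) =
   (\<Sum>e\<in>edges M. count (ends M e) v) + card {i \<in> semiedges M. attach M i = Incident v}"
proof -
  have "size (\<Sum>e\<in>A. f e) = (\<Sum>e\<in>A. size (f e))" for A :: "'b set" and f :: "'b \<Rightarrow> 'b link multiset"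
    by (induction A rule: infinite_finite_induct) auto
  then show ?thesis
    unfolding incident_def by (simp add: card_image inj_on_def)
qed

text \<open>Double counting of incidences: an edge contributes two, a loop both at the same vertex,
  and a semiedge one, as none is paired.\<close>

lemma handshake:
  assumes "multipole M" "\<And>i. i \<in> semiedges M \<Longrightarrow> \<exists>v. attach M i = Incident v"
  shows "3 * card (verts M) = 2 * card (edges M) + arity M"
proof -
  have fin: "finite (verts M)" "finite (edges M)" "finite (semiedges M)"
    using assms(1) by (auto simp: multipole_def semiedges_def)
  have "(\<Sum>v\<in>verts M. count (ends M e) v) = 2" if "e \<in> edges M" for e
  proof -
    have "set_mset (ends M e) \<subseteq> verts M" "size (ends M e) = 2"
      using assms(1) that by (auto simp: multipole_def)
    moreover from this have "(\<Sum>v\<in>verts M. count (ends M e) v) = (\<Sum>v\<in>set_mset (ends M e). count (ends M e) v)"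
      using fin by (intro sum.mono_neutral_right) (auto simp: count_eq_zero_iff)
    ultimately show ?thesis
      by (simp add: size_multiset_overloaded_eq)
  qed
  then have E: "(\<Sum>v\<in>verts M. \<Sum>e\<in>edges M. count (ends M e) v) = 2 * card (edges M)"
    by (subst sum.swap) simp
  have "semiedges M = (\<Union>v\<in>verts M. {i \<in> semiedges M. attach M i = Incident v})"
  proof -
    have "v \<in> verts M" if "i \<in> semiedges M" "attach M i = Incident v" for i v
      using assms(1) that by (auto simp: multipole_def dest!: bspec)
    then have "\<exists>v \<in> verts M. attach M i = Incident v" if "i \<in> semiedges M" for i
      using assms(2)[OF that] that by metis
    then show ?thesis
      by auto
  qed
  then have "card (semiedges M) = card (\<Union>v\<in>verts M. {i \<in> semiedges M. attach M i = Incident v})"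
    by (rule arg_cong)
  also have "\<dots> = (\<Sum>v\<in>verts M. card {i \<in> semiedges M. attach M i = Incident v})"
    using fin by (intro card_UN_disjoint) auto
  finally have S: "arity M = (\<Sum>v\<in>verts M. card {i \<in> semiedges M. attach M i = Incident v})"
    by (simp add: semiedges_def)
  have "3 * card (verts M) = (\<Sum>v\<in>verts M. size (incident M v))"
    using assms(1) by (simp add: multipole_def)
  also have "\<dots> = 2 * card (edges M) + arity M"
    unfolding size_incident sum.distrib E S[symmetric] ..
  finally show ?thesis .
qed

section \<open>Placement of the semiedges\<close>

lemma no_free_edge:
  assumes "multipole M" "color_complete M" "arity M \<ge> 5" "i \<in> semiedges M"
  shows "\<exists>v. attach M i = Incident v"
proof (cases "attach M i")
  case (Paired j)
  then have j: "j \<in> semiedges M" "j \<noteq> i"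
    using assms(1,4) by (auto simp: multipole_def dest!: bspec)
  \<comment> \<open>Colours 1 and 2 are prescribed on the two halves of the free edge, which must
    agree.\<close>
  then have "\<exists>\<phi>. tait_coloring M \<phi> \<and> (\<forall>k \<in> {i, j}. \<phi> (Semi k) = (if k = i then 1 else 2))"
    using assms(4) by (intro ex_coloring assms(2,3)) (auto simp: semiedges_def card_insert_if)
  then obtain \<phi> where "tait_coloring M \<phi>" "\<forall>k \<in> {i, j}. \<phi> (Semi k) = (if k = i then 1 else 2)"
    by blast
  then have "\<phi> (Semi i) \<noteq> \<phi> (Semi j)" "tait_coloring M \<phi>"
    using j(2) by auto
  then show ?thesis
    using Paired assms(4) by (simp add: tait_coloring_def)
qed auto

text \<open>Otherwise both semiedges at the common vertex could be given colour 1.\<close>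

lemma attach_inj:
  assumes "multipole M" "color_complete M" "arity M \<ge> 5" "i \<in> semiedges M" "j \<in> semiedges M"
    and "attach M i = Incident v" "attach M j = Incident v"
  shows "i = j"
proof (rule ccontr)
  assume "i \<noteq> j"
  have "\<exists>\<phi>. tait_coloring M \<phi> \<and> (\<forall>k \<in> {i, j}. \<phi> (Semi k) = 1)"
    using assms(4,5) by (intro ex_coloring assms(2,3)) (auto simp: semiedges_def card_insert_if)
  then obtain \<phi> where \<phi>: "tait_coloring M \<phi>" "\<phi> (Semi i) = 1" "\<phi> (Semi j) = 1"
    by blast
  have "v \<in> verts M"
    using assms(1,4,6) by (auto simp: multipole_def dest!: bspec)
  moreover have "{#Semi i, Semi j#} \<subseteq># incident M v"
    using count_incident_Semi[OF assms(4,6)] count_incident_Semi[OF assms(5,7)] \<open>i \<noteq> j\<close>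
    by (intro pair_subset_mset) (simp_all flip: count_greater_zero_iff)
  ultimately show False
    using coloring_neq[OF \<phi>(1)] \<phi>(2,3) by metis
qed

text \<open>If every vertex carried a semiedge, colouring the semiedge at \<open>v\<close> with 1 and those at its two
  neighbours (possibly one and the same vertex) with 2 would force colour 3 on both edges at \<open>v\<close>.\<close>

lemma ex_vertex_without_semiedge:
  assumes M: "multipole M" "color_complete M" "arity M \<ge> 5"
  shows "\<exists>v \<in> verts M. \<forall>i \<in> semiedges M. attach M i \<noteq> Incident v"
proof (rule ccontr)
  assume "\<not> ?thesis"
  then have full: "\<exists>i \<in> semiedges M. attach M i = Incident v" if "v \<in> verts M" for v
    using that by blast
  have fin: "finite (edges M)"
    using M(1) by (simp add: multipole_def)
  have "1 \<in> semiedges M"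
    using M(3) by (simp add: semiedges_def)
  then obtain v where v: "attach M 1 = Incident v" "v \<in> verts M"
    using no_free_edge[OF M, of 1] M(1) by (auto simp: multipole_def dest!: bspec)
  \<comment> \<open>Any colouring will do here: its existence alone excludes loops.\<close>
  obtain \<psi> where \<psi>: "tait_coloring M \<psi>"
    using ex_coloring[OF M(2,3), of "{}" "\<lambda>_. 1"] by auto
  have no_double: "count (incident M u) l \<le> 1" if "u \<in> verts M" for u l
  proof (rule ccontr)
    assume "\<not> ?thesis"
    then have "{#l, l#} \<subseteq># incident M u"
      by (auto simp: subseteq_mset_def)
    then show False
      using coloring_neq[OF \<psi> that] by blast
  qed
  have "{i \<in> semiedges M. attach M i = Incident v} = {1}"
    using attach_inj[OF M] v(1) \<open>1 \<in> semiedges M\<close> by blast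
  \<comment> \<open>One of the three incidences at \<open>v\<close> is its only semiedge; without
    loops, the other two belong to two different edges.\<close>
  then have deg: "(\<Sum>e\<in>edges M. count (ends M e) v) = 2"
    using M(1) v(2) size_incident[of M v] by (simp add: multipole_def)
  have le1: "count (ends M e) u \<le> 1" if "e \<in> edges M" "u \<in> verts M" for e u
    using no_double[OF that(2), of "Edge e"] count_incident_Edge[OF fin that(1)] by simp
  have "(\<Sum>e\<in>edges M. count (ends M e) v) = (\<Sum>e\<in>edges M. if v \<in># ends M e then 1 else 0)"
  proof (intro sum.cong refl)
    fix e assume "e \<in> edges M"
    then show "count (ends M e) v = (if v \<in># ends M e then 1 else 0)"
      using le1[of e v] v(2) by (cases "count (ends M e) v") (auto simp: count_eq_zero_iff[symmetric] simp del: count_eq_zero_iff)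
  qed
  then have "card {e \<in> edges M. v \<in># ends M e} = 2"
    using deg fin by (simp add: sum.If_cases Int_def)
  then obtain e f where ef: "e \<noteq> f" "{e' \<in> edges M. v \<in># ends M e'} = {e, f}"
    by (auto simp: card_2_iff)
  have other: "\<exists>u k. u \<in> verts M \<and> k \<in> semiedges M \<and> k \<noteq> 1 \<and> attach M k = Incident u \<and> u \<in># ends M e'"
    if e': "e' \<in> {e, f}" for e'
  proof -
    have 1: "e' \<in> edges M" "v \<in># ends M e'"
      using ef(2) e' by blast+
    then have 2: "size (ends M e') = 2" "set_mset (ends M e') \<subseteq> verts M"
      using M(1) by (auto simp: multipole_def)
    obtain A where A: "ends M e' = add_mset v A"
      using 1(2) by (metis multi_member_split)
    then have "size A = 1"
      using 2(1) by simp
    then obtain u where u: "ends M e' = {#v, u#}" "u \<in> verts M"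
      using A 2(2) size_1_singleton_mset[of A] by auto
    have "u \<noteq> v"
      using le1[OF 1(1) v(2)] u(1) by auto
    moreover obtain k where "k \<in> semiedges M" "attach M k = Incident u"
      using full u(2) by blast
    moreover from calculation have "k \<noteq> 1"
      using v(1) by auto
    moreover have "u \<in># ends M e'"
      using u(1) by simp
    ultimately show ?thesis
      using u(2) by blast
  qed
  obtain u j where u: "u \<in> verts M" "j \<in> semiedges M" "j \<noteq> 1" "attach M j = Incident u" "u \<in># ends M e"
    using other[of e] by blast
  obtain w k where w: "w \<in> verts M" "k \<in> semiedges M" "k \<noteq> 1" "attach M k = Incident w" "w \<in># ends M f"
    using other[of f] by blast
  \<comment> \<open>If the two edges are parallel, \<open>j\<close> and \<open>k\<close> may
    coincide; both receive colour 2, so the prescription stays consistent.\<close>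
  have "\<exists>\<phi>. tait_coloring M \<phi> \<and> (\<forall>i \<in> {1, j, k}. \<phi> (Semi i) = (if i = 1 then 1 else 2))"
    using u(2) w(2) \<open>1 \<in> semiedges M\<close>
    by (intro ex_coloring M(2,3)) (auto simp: semiedges_def card_insert_if)
  then obtain \<phi> where \<phi>: "tait_coloring M \<phi>" "\<phi> (Semi 1) = 1" "\<phi> (Semi j) = 2" "\<phi> (Semi k) = 2"
    using u(3) w(3) by auto
  have neq: "\<phi> (Edge e') \<noteq> \<phi> (Semi i)"
    if "e' \<in> edges M" "x \<in># ends M e'" "x \<in> verts M" "i \<in> semiedges M" "attach M i = Incident x" for e' x i
  proof (rule coloring_neq[OF \<phi>(1) that(3)])
    show "{#Edge e', Semi i#} \<subseteq># incident M x"
      using that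
      by (intro pair_subset_mset) (simp_all add: count_incident_Edge fin count_incident_Semi flip: count_greater_zero_iff)
  qed
  have e: "e \<in> edges M" "v \<in># ends M e" and f: "f \<in> edges M" "v \<in># ends M f"
    using ef(2) by blast+
  have "\<phi> (Edge e) \<in> {1, 2, 3}" "\<phi> (Edge f) \<in> {1, 2, 3}"
    using coloring_range[OF \<phi>(1)] e(1) f(1) by (simp_all add: links_def del: insert_iff)
  moreover have "\<phi> (Edge e) \<noteq> 1" "\<phi> (Edge f) \<noteq> 1"
    using neq[OF e v(2) \<open>1 \<in> semiedges M\<close> v(1)] neq[OF f v(2) \<open>1 \<in> semiedges M\<close> v(1)] \<phi>(2) by simp_all
  moreover have "\<phi> (Edge e) \<noteq> 2" "\<phi> (Edge f) \<noteq> 2"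
    using neq[OF e(1) u(5,1,2,4)] neq[OF f(1) w(5,1,2,4)] \<phi>(3,4) by simp_all
  \<comment> \<open>Only colour 3 is left for either edge.\<close>
  ultimately have "\<phi> (Edge e) = \<phi> (Edge f)"
    by simp
  moreover have "{#Edge e, Edge f#} \<subseteq># incident M v"
    using e f ef(1)
    by (intro pair_subset_mset) (simp_all add: count_incident_Edge fin flip: count_greater_zero_iff)
  ultimately show False
    using coloring_neq[OF \<phi>(1) v(2)] by blast
qed

lemma card_verts_ge:
  assumes M: "multipole M" "color_complete M" "arity M \<ge> 5"
  shows "arity M + 2 \<le> card (verts M)"
proof -
  define h where "h i = (THE v. attach M i = Incident v)" for i
  have h: "attach M i = Incident (h i)" if "i \<in> semiedges M" for i
    using no_free_edge[OF M that] by (auto simp: h_def)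
  obtain v where v: "v \<in> verts M" "\<And>i. i \<in> semiedges M \<Longrightarrow> attach M i \<noteq> Incident v"
    using ex_vertex_without_semiedge[OF M] by blast
  have "h i \<in> verts M" if "i \<in> semiedges M" for i
    using M(1) that h[OF that] by (auto simp: multipole_def dest!: bspec)
  then have "h ` semiedges M \<subseteq> verts M - {v}"
    using h v(2) by force
  moreover have "inj_on h (semiedges M)"
    using attach_inj[OF M] h by (metis inj_onI)
  moreover have "finite (verts M)"
    using M(1) by (simp add: multipole_def)
  ultimately have "card (semiedges M) \<le> card (verts M - {v})"
    by (metis card_image card_mono finite_Diff)
  also have "\<dots> < card (verts M)"
    using \<open>finite (verts M)\<close> v(1) by (rule card_Diff1_less)
  finally have "arity M < card (verts M)"
    by (simp add: semiedges_def)
  \<comment> \<open>This makes the number of vertices congruent to the arity modulo 2, so exceeding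
    it means exceeding it by at least 2.\<close>
  moreover have "3 * card (verts M) = 2 * card (edges M) + arity M"
    using handshake[OF M(1) no_free_edge[OF M]] .
  ultimately show ?thesis
    by presburger
qed

theorem proposition3p3:
  fixes m :: nat
  assumes "m \<ge> 5"
  shows "(odd m \<longrightarrow> m + 2 \<le> min_color_complete m \<and> min_color_complete m \<le> 10 * m - 37) \<and>
         (even m \<longrightarrow> m + 2 \<le> min_color_complete m \<and> min_color_complete m \<le> 10 * m - 40)"
proof -
  obtain es ss where ss: "length ss = m" "complete (7 * m - 24) es ss"
    using ex_complete[OF assms] by blast
  then have "ss \<noteq> []"
    using assms by auto
  let ?S = "{card (verts M) | M :: (nat, nat) mpole. multipole M \<and> arity M = m \<and> color_complete M}"
  have S: "7 * m - 24 \<in> ?S"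
    using complete_imp_mpole[OF ss(2) \<open>ss \<noteq> []\<close>] unfolding ss(1) .
  then have upper: "min_color_complete m \<le> 7 * m - 24"
    unfolding min_color_complete_def by (rule cInf_lower) simp
  \<comment> \<open>Nonemptiness makes the infimum an attained value, to which the bound for
    individual multipoles applies.\<close>
  have "?S \<noteq> {}"
    using S by blast
  then have "min_color_complete m \<in> ?S"
    unfolding min_color_complete_def by (rule Inf_nat_def1)
  then have "m + 2 \<le> min_color_complete m"
    using card_verts_ge assms by auto
  \<comment> \<open>\<open>7 * m - 24\<close> is at most \<open>10 * m - 37\<close> from 5 on, but
    at most \<open>10 * m - 40\<close> only from 6 on.\<close>
  moreover have "m \<noteq> 5" if "even m"
    using that by auto
  ultimately show ?thesis
    using upper assms by (auto; linarith)
qed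

end
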